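(* Let $\varphi = \frac{1+\sqrt5}{2}$. (1) There is no non-trivial (i.e. not identically zero) integer-valued polynomial $P$ satisfying $$\sum_{n\ge 0} |P(n)|^2 \varphi^{-2n} < \varphi.$$ (2) For every $\varepsilon > 0$ there are infinitely many integer-valued polynomials $P$ that satisfy $$\sum_{n\ge 0} \frac{1}{n+1}\, |P(n)|^2 \varphi^{-2n} \le \frac{2}{\pi} + \varepsilon.$$
   Context: An integer-valued polynomial is a polynomial $P$ (of arbitrary degree) that takes integer values on $\mathbb{N} = \{0,1,2,\dots\}$ (equivalently, on $\mathbb{Z}$). *)

theory Defs
  imports "HOL-Analysis.Analysis" "HOL-Real_Asymp.Real_Asymp" "HOL-Computational_Algebra.Polynomial"
begin

text \<open>
  Polynomials are taken with real coefficients. This loses nothing: a polynomial over any field of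
  characteristic zero that takes integer values on the naturals has rational coefficients.
\<close>

definition integer_valued :: "real poly \<Rightarrow> bool"
  where "integer_valued P \<longleftrightarrow> (\<forall>n::nat. poly P (real n) \<in> \<int>)"

definition golden_ratio :: real
  where "golden_ratio = (1 + sqrt 5) / 2"

text \<open>
  The series in the theorem are written with \<^const>\<open>suminf\<close>, which is only meaningful for
  convergent series. The following facts show that they always converge.
\<close>

lemma golden_ratio_gt_1: "golden_ratio > 1"
  unfolding golden_ratio_def using real_less_rsqrt[of 1 5] by simp

lemma golden_ratio_powi: "golden_ratio powi (- 2 * int n) = (1 / golden_ratio\<^sup>2) ^ n"
proof -
  have "golden_ratio powi (- 2 * int n) = inverse (golden_ratio powi int (2 * n))"
    by (simp add: power_int_minus)
  also have "\<dots> = (1 / golden_ratio\<^sup>2) ^ n"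
    by (simp only: power_int_of_nat) (simp add: power_mult divide_inverse power_inverse)
  finally show ?thesis .
qed

lemma summable_poly_geometric:
  fixes P :: "real poly"
  assumes "0 < c" "c < 1"
  shows "summable (\<lambda>n. poly P (real n) * c ^ n)"
proof -
  have *: "summable (\<lambda>n. real n ^ i * c ^ n)" for i
  proof (rule summable_comparison_test_bigo)
    show "summable (\<lambda>n. norm (inverse (real n ^ 2)))"
      using inverse_power_summable[of 2, where 'a = real] by simp
    show "(\<lambda>n. real n ^ i * c ^ n) \<in> O(\<lambda>n. inverse (real n ^ 2))"
      using assms by real_asymp
  qed
  have "summable (\<lambda>n. \<Sum>i\<le>degree P. coeff P i * (real n ^ i * c ^ n))"
    by (intro summable_sum summable_mult *)
  then show ?thesis
    by (simp add: poly_altdef sum_distrib_right mult.assoc)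
qed

lemma summable_sum_1:
  "summable (\<lambda>n. \<bar>poly P (real n)\<bar>\<^sup>2 * golden_ratio powi (- 2 * int n))"
proof -
  have "1 < golden_ratio\<^sup>2"
    using golden_ratio_gt_1 by (simp add: one_less_power)
  then have "summable (\<lambda>n. poly (P\<^sup>2) (real n) * (1 / golden_ratio\<^sup>2) ^ n)"
    using golden_ratio_gt_1 by (intro summable_poly_geometric) (simp_all add: divide_less_eq)
  then show ?thesis
    by (simp only: golden_ratio_powi power2_abs poly_power)
qed

lemma summable_sum_2:
  "summable (\<lambda>n. 1 / real (n + 1) * \<bar>poly P (real n)\<bar>\<^sup>2 * golden_ratio powi (- 2 * int n))"
proof (rule summable_comparison_test'[OF summable_sum_1[of P]])
  fix n :: nat
  have "0 \<le> golden_ratio powi (- 2 * int n)"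
    using golden_ratio_gt_1 by (intro zero_le_power_int) simp
  then have "1 / real (n + 1) * (\<bar>poly P (real n)\<bar>\<^sup>2 * golden_ratio powi (- 2 * int n))
      \<le> 1 * (\<bar>poly P (real n)\<bar>\<^sup>2 * golden_ratio powi (- 2 * int n))"
    by (intro mult_right_mono mult_nonneg_nonneg) auto
  then show "norm (1 / real (n + 1) * \<bar>poly P (real n)\<bar>\<^sup>2 * golden_ratio powi (- 2 * int n))
      \<le> \<bar>poly P (real n)\<bar>\<^sup>2 * golden_ratio powi (- 2 * int n)"
    using \<open>0 \<le> golden_ratio powi _\<close> by (simp add: abs_mult mult.assoc)
qed

end

theory Submission
  imports Defs
begin

text \<open>
  Write a polynomial as \<open>\<Sum>k. a k * (n choose k)\<close> and put \<open>G(w) = \<Sum>k. a k * w ^ k\<close>; it is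
  integer-valued exactly if all \<open>a k\<close> are integers. Under the substitution \<open>w = z / (1 - z)\<close>,
  which occurs in the generating function of the values, the circle of radius
  \<open>inv_phi = 1 / golden_ratio\<close> around zero goes to the circle of radius one around \<open>inv_phi\<close>.
  That the image has radius exactly one is what singles out the golden ratio.

  For the weights \<open>golden_ratio powi (- 2 * n)\<close> this means that the powers of \<open>w - inv_phi\<close>
  are orthogonal with squared norm \<open>golden_ratio\<close> (\<open>newton_parseval\<close>). The expansion of \<open>G\<close> in
  these powers has the same leading coefficient as \<open>G\<close>, a nonzero integer, so the squared norm
  is at least \<open>golden_ratio\<close> (\<open>newton_norm_ge_golden_ratio\<close>).

  For the second part, take \<open>G(w) = w K(w)\<close> and enlarge the weight \<open>1 / (n + 1)\<close> to \<open>1 / n\<close>.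
  The squared norm becomes \<open>\<Sum>k. (b k)\<^sup>2 / (k + 1)\<close>, where the \<open>b k\<close> are the coefficients of
  \<open>K\<close> in powers of \<open>w - inv_phi\<close> (\<open>newton_dirichlet_norm\<close>). The change from the coefficients
  of \<open>K\<close> to the \<open>b k\<close> is unitriangular, so for \<open>K\<close> of degree less than \<open>n\<close> this is a quadratic
  form of determinant \<open>1 / fact n\<close> on a lattice of covolume one. Minkowski's theorem, in the
  form of \<open>blichfeldt\<close>, gives a nonzero \<open>K\<close> of squared norm at most about
  \<open>(2 * n / (pi * exp 1)) * (exp 1 / n) = 2 / pi\<close> for large \<open>n\<close>. Passing to a sublattice of
  fixed index does not change the limit, so divisibility by \<open>M\<close> can be imposed on the first
  \<open>s\<close> coefficients, and hence on the first values of the polynomial. Since \<open>M\<close> and \<open>s\<close> are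
  arbitrary, the polynomials found this way do not lie in a finite set.
\<close>

section \<open>The weight\<close>

text \<open>
  The reciprocal of the golden ratio.
\<close>

definition inv_phi :: real where "inv_phi = golden_ratio - 1"

lemma golden_ratio_sq: "golden_ratio\<^sup>2 = golden_ratio + 1"
  unfolding golden_ratio_def by (simp add: power2_eq_square field_simps)

lemma inv_phi_pos: "0 < inv_phi" using golden_ratio_gt_1 by (simp add: inv_phi_def)

lemma inv_phi_sq: "inv_phi\<^sup>2 = 1 - inv_phi"
  using golden_ratio_sq by (simp add: inv_phi_def power2_eq_square algebra_simps)

lemma inv_phi_lt_1: "inv_phi < 1"
  using inv_phi_sq inv_phi_pos zero_less_power2[of inv_phi] by linarith

lemma golden_ratio_inv_phi: "golden_ratio * inv_phi = 1"
  using golden_ratio_sq by (simp add: inv_phi_def power2_eq_square algebra_simps)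

lemma weight_eq: "golden_ratio powi (- 2 * int n) = (inv_phi\<^sup>2) ^ n"
proof -
  have "1 / golden_ratio = inv_phi"
    using golden_ratio_inv_phi golden_ratio_gt_1 by (simp add: field_simps)
  then show ?thesis
    by (metis golden_ratio_powi power_one_over)
qed

section \<open>Newton expansions\<close>

text \<open>
  The values on the naturals of the polynomial with Newton coefficients \<open>coeff G k\<close>. Packing
  the coefficients into a polynomial \<open>G\<close> in a variable \<open>w\<close> turns operations on the values into
  ring operations: the generating function of the values is \<open>(1 + w) G(w)\<close> at
  \<open>w = z / (1 - z)\<close>.
\<close>

definition newton :: "real poly \<Rightarrow> nat \<Rightarrow> real"
  where "newton G n = (\<Sum>k\<le>n. coeff G k * real (n choose k))"

lemma newton_0 [simp]: "newton 0 n = 0"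
  by (simp add: newton_def)

lemma newton_add: "newton (G + H) n = newton G n + newton H n"
  by (simp add: newton_def sum.distrib algebra_simps)

lemma newton_diff: "newton (G - H) n = newton G n - newton H n"
  by (simp add: newton_def sum_subtractf algebra_simps)

lemma newton_smult: "newton (smult a G) n = a * newton G n"
  by (simp add: newton_def sum_distrib_left mult.assoc)

lemma newton_const: "newton [:a:] n = a"
proof -
  have "newton [:a:] n = (\<Sum>k\<le>n. if k = 0 then a else 0)"
    unfolding newton_def by (intro sum.cong refl) (auto simp: coeff_pCons split: nat.split)
  then show ?thesis by simp
qed

lemma newton_monom: "newton (monom a k) n = a * real (n choose k)"
proof -
  have "newton (monom a k) n = (\<Sum>j\<le>n. if j = k then a * real (n choose k) else 0)"
    unfolding newton_def by (intro sum.cong refl) auto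
  then show ?thesis by (simp add: binomial_eq_0)
qed

lemma newton_pCons_0: "newton (pCons a G) 0 = a"
  by (simp add: newton_def)

lemma newton_eq_sum_le:
  assumes "n \<le> m"
  shows "newton G n = (\<Sum>k\<le>m. coeff G k * real (n choose k))"
  unfolding newton_def using assms by (intro sum.mono_neutral_left) auto

lemma newton_shift: "newton (pCons 0 G) (Suc n) = newton (pCons 0 G) n + newton G n"
proof -
  have "newton (pCons 0 G) (Suc n) = (\<Sum>k\<le>n. coeff G k * real (Suc n choose Suc k))"
    unfolding newton_def sum.atMost_Suc_shift by simp
  moreover have "newton (pCons 0 G) n = (\<Sum>k\<le>n. coeff G k * real (n choose Suc k))"
    using newton_eq_sum_le[of n "Suc n" "pCons 0 G"] unfolding sum.atMost_Suc_shift by simp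
  ultimately show ?thesis
    by (simp add: newton_def sum.distrib algebra_simps)
qed

text \<open>
  Dividing the values by \<open>n\<close> corresponds to integrating \<open>G\<close>, by the absorption identity
  \<open>k * (n choose k) = n * (n - 1 choose k - 1)\<close>. This is what makes the weight \<open>1/n\<close>
  tractable.
\<close>

lemma newton_times_pderiv:
  "newton (pCons 0 (pderiv G)) (Suc n) = real (Suc n) * (newton G (Suc n) - newton G n)"
proof -
  have *: "real (Suc k) * real (Suc n choose Suc k) = real (Suc n) * real (n choose k)" for k
    by (metis Suc_times_binomial_eq mult.commute of_nat_mult)
  have "newton G (Suc n) - newton G n
      = (\<Sum>k\<le>Suc n. coeff G k * (real (Suc n choose k) - real (n choose k)))"
    using newton_eq_sum_le[of n "Suc n" G] newton_eq_sum_le[of "Suc n" "Suc n" G]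
    by (simp only: right_diff_distrib sum_subtractf)
  also have "\<dots> = (\<Sum>k\<le>n. coeff G (Suc k) * real (n choose k))"
    unfolding sum.atMost_Suc_shift by simp
  finally have "real (Suc n) * (newton G (Suc n) - newton G n)
      = (\<Sum>k\<le>n. coeff G (Suc k) * (real (Suc n) * real (n choose k)))"
    by (simp add: sum_distrib_left mult_ac)
  also have "\<dots> = (\<Sum>k\<le>n. coeff G (Suc k) * (real (Suc k) * real (Suc n choose Suc k)))"
    by (simp only: *)
  also have "\<dots> = newton (pCons 0 (pderiv G)) (Suc n)"
    unfolding newton_def sum.atMost_Suc_shift by (simp add: coeff_pderiv mult_ac del: binomial_Suc_Suc)
  finally show ?thesis ..
qed

definition binom_poly :: "nat \<Rightarrow> real poly"
  where "binom_poly k = smult (1 / fact k) (\<Prod>i<k. [:- real i, 1:])"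

lemma poly_binom_poly: "poly (binom_poly k) (real n) = real (n choose k)"
  by (simp add: binom_poly_def binomial_gbinomial gbinomial_prod_rev poly_prod atLeast0LessThan)

lemma degree_binom_poly: "degree (binom_poly k) \<le> k"
proof -
  have "degree (\<Prod>i<k. [:- real i, 1:]) \<le> (\<Sum>i<k. degree [:- real i, 1:])"
    using degree_prod_sum_le[of "{..<k}" "\<lambda>i. [:- real i, 1:]"] by (simp add: o_def)
  also have "\<dots> = k" by simp
  finally show ?thesis
    unfolding binom_poly_def using degree_smult_le le_trans by blast
qed

definition newton_poly :: "real poly \<Rightarrow> real poly"
  where "newton_poly G = (\<Sum>k\<le>degree G. smult (coeff G k) (binom_poly k))"

lemma poly_newton_poly: "poly (newton_poly G) (real n) = newton G n"
proof -
  have "poly (newton_poly G) (real n) = (\<Sum>k\<le>degree G. coeff G k * real (n choose k))"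
    by (simp add: newton_poly_def poly_sum poly_binom_poly)
  also have "\<dots> = (\<Sum>k\<le>max n (degree G). coeff G k * real (n choose k))"
    by (intro sum.mono_neutral_left) (auto simp: coeff_eq_0)
  also have "\<dots> = newton G n"
    by (rule newton_eq_sum_le[symmetric]) simp
  finally show ?thesis .
qed

lemma degree_newton_poly: "degree (newton_poly G) \<le> degree G"
  unfolding newton_poly_def
  by (intro degree_sum_le) (auto intro: order.trans[OF degree_smult_le] order.trans[OF degree_binom_poly])

lemma integer_valued_newton_poly:
  assumes "\<And>k. coeff G k \<in> \<int>"
  shows "integer_valued (newton_poly G)"
  unfolding integer_valued_def poly_newton_poly newton_def using assms by auto

text \<open>
  The binomial matrix is unitriangular, so integer values have integer Newton coefficients:
  each new coefficient corrects the next value and leaves the earlier ones alone.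
\<close>

lemma newton_interpolation:
  fixes f :: "nat \<Rightarrow> real"
  assumes "\<And>n. f n \<in> \<int>"
  shows "\<exists>G. (\<forall>k. coeff G k \<in> \<int>) \<and> degree G \<le> N \<and> (\<forall>n\<le>N. newton G n = f n)"
proof (induction N)
  case 0
  show ?case using assms
    by (intro exI[of _ "[:f 0:]"]) (auto simp: newton_const coeff_pCons split: nat.split)
next
  case (Suc N)
  then obtain G where G: "\<And>k. coeff G k \<in> \<int>" "degree G \<le> N" "\<And>n. n \<le> N \<Longrightarrow> newton G n = f n"
    by blast
  define G' where "G' = G + monom (f (Suc N) - newton G (Suc N)) (Suc N)"
  have "newton G (Suc N) \<in> \<int>" unfolding newton_def using G(1) by auto
  then have "coeff G' k \<in> \<int>" for k
    using G(1) assms by (auto simp: G'_def)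
  moreover have "degree G' \<le> Suc N"
    unfolding G'_def using G(2) by (intro degree_add_le degree_monom_le) auto
  moreover have "newton G' n = f n" if "n \<le> Suc N" for n
    using that G(3) by (cases "n = Suc N") (auto simp: G'_def newton_add newton_monom)
  ultimately show ?case by blast
qed

lemma integer_valued_eq_newton_poly:
  assumes "integer_valued P"
  shows "\<exists>G. (\<forall>k. coeff G k \<in> \<int>) \<and> P = newton_poly G"
proof -
  obtain G where G: "\<forall>k. coeff G k \<in> \<int>" "degree G \<le> degree P"
      "\<And>n. n \<le> degree P \<Longrightarrow> newton G n = poly P (real n)"
    using newton_interpolation[of "\<lambda>n. poly P (real n)" "degree P"] assms
    unfolding integer_valued_def by blast
  have "card (real ` {..degree P}) = Suc (degree P)"
    by (simp add: card_image)
  moreover have "degree (newton_poly G) \<le> degree P"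
    using degree_newton_poly G(2) le_trans by blast
  ultimately have "P = newton_poly G"
    using G(3) by (intro poly_eqI_degree[of "real ` {..degree P}"]) (auto simp: poly_newton_poly)
  with G(1) show ?thesis by blast
qed

section \<open>Parseval identity for the geometric weight\<close>

lemma inv_phi_sq_bounds: "0 < inv_phi\<^sup>2" "inv_phi\<^sup>2 < 1"
  using inv_phi_sq inv_phi_pos inv_phi_lt_1 by auto

lemma summable_newton: "summable (\<lambda>n. newton G n * (inv_phi\<^sup>2) ^ n)"
  using summable_poly_geometric[OF inv_phi_sq_bounds, of "newton_poly G"] by (simp add: poly_newton_poly)

lemma summable_newton_mult: "summable (\<lambda>n. newton G n * newton H n * (inv_phi\<^sup>2) ^ n)"
  using summable_poly_geometric[OF inv_phi_sq_bounds, of "newton_poly G * newton_poly H"]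
  by (simp add: poly_newton_poly)

lemma newton_times_linear:
  "newton ([:- a, 1:] * G) n = newton (pCons 0 G) n - a * newton G n"
  by (simp add: newton_diff newton_smult)

text \<open>
  On generating functions, multiplication by \<open>w - inv_phi\<close> is multiplication by
  \<open>(golden_ratio * z - inv_phi) / (1 - z)\<close>; clearing the denominator gives this recurrence.
\<close>

lemma newton_linear_factor:
  "newton ([:- inv_phi, 1:] * G) (Suc n) + inv_phi * newton G (Suc n)
   = newton ([:- inv_phi, 1:] * G) n + golden_ratio * newton G n"
proof -
  show ?thesis unfolding newton_times_linear newton_shift by (simp add: inv_phi_def algebra_simps)
qed

text \<open>
  The same recurrence one step earlier, with the values at \<open>-1\<close> read as zero.
\<close>

lemma newton_linear_factor_0: "newton ([:- inv_phi, 1:] * G) 0 + inv_phi * newton G 0 = 0"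
  by (simp add: newton_def)

lemma suminf_shift_eq:
  fixes f g :: "nat \<Rightarrow> real"
  assumes "summable f" "summable g" "f 0 = 0" "\<And>n. f (Suc n) = g n"
  shows "suminf f = suminf g"
  using suminf_split_head[OF assms(1)] assms(3,4) by simp

text \<open>
  The constants are orthogonal to the range of multiplication by \<open>w - inv_phi\<close>: summing the
  recurrence against the weights, the terms of the cofactor \<open>G\<close> cancel because
  \<open>inv_phi\<^sup>2 * golden_ratio = inv_phi\<close>.
\<close>

lemma suminf_linear_factor_eq_0:
  "(\<Sum>n. newton ([:- inv_phi, 1:] * G) n * (inv_phi\<^sup>2) ^ n) = 0"
proof -
  let ?g = "newton ([:- inv_phi, 1:] * G)" and ?f = "newton G" and ?c = "\<lambda>n. (inv_phi\<^sup>2) ^ n"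
  have s: "(\<Sum>n. (?g n + inv_phi * ?f n) * ?c n) = (\<Sum>n. inv_phi\<^sup>2 * ((?g n + golden_ratio * ?f n) * ?c n))"
  proof (rule suminf_shift_eq)
    show "(?g (Suc n) + inv_phi * ?f (Suc n)) * ?c (Suc n) = inv_phi\<^sup>2 * ((?g n + golden_ratio * ?f n) * ?c n)" for n
      unfolding newton_linear_factor by simp
  qed (simp_all only: newton_linear_factor_0 distrib_right mult.assoc,
       auto intro!: summable_add summable_mult summable_newton)
  have "(\<lambda>n. (?g n + inv_phi * ?f n) * ?c n) sums ((\<Sum>n. ?g n * ?c n) + inv_phi * (\<Sum>n. ?f n * ?c n))"
    unfolding distrib_right mult.assoc
    by (intro sums_add sums_mult summable_sums summable_newton)
  moreover have "(\<lambda>n. inv_phi\<^sup>2 * ((?g n + golden_ratio * ?f n) * ?c n)) sums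
      (inv_phi\<^sup>2 * ((\<Sum>n. ?g n * ?c n) + golden_ratio * (\<Sum>n. ?f n * ?c n)))"
    unfolding distrib_right mult.assoc
    by (intro sums_add sums_mult summable_sums summable_newton)
  ultimately have "(\<Sum>n. ?g n * ?c n) + inv_phi * (\<Sum>n. ?f n * ?c n)
     = inv_phi\<^sup>2 * (\<Sum>n. ?g n * ?c n) + inv_phi * (golden_ratio * inv_phi) * (\<Sum>n. ?f n * ?c n)"
    using s by (simp add: sums_iff power2_eq_square algebra_simps)
  then show ?thesis unfolding golden_ratio_inv_phi inv_phi_sq
    using inv_phi_pos by (simp add: algebra_simps)
qed

text \<open>
  The factor \<open>(golden_ratio * z - inv_phi) / (1 - z)\<close> has modulus one on the circle
  \<open>\<bar>z\<bar> = inv_phi\<close>, so multiplication by \<open>w - inv_phi\<close> preserves the weighted inner product.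
  The elementary form of this argument is to multiply the recurrences of \<open>G\<close> and \<open>H\<close> and sum
  against the weights: the mixed terms cancel since \<open>inv_phi\<^sup>2 * golden_ratio = inv_phi\<close>, and
  both sides keep the factor \<open>1 - inv_phi\<^sup>2\<close>.
\<close>

lemma linear_factor_isometry:
  "(\<Sum>n. newton ([:- inv_phi, 1:] * G) n * newton ([:- inv_phi, 1:] * H) n * (inv_phi\<^sup>2) ^ n)
   = (\<Sum>n. newton G n * newton H n * (inv_phi\<^sup>2) ^ n)"
proof -
  define g h where "g = newton ([:- inv_phi, 1:] * G)" and "h = newton ([:- inv_phi, 1:] * H)"
  define g' h' where "g' = newton G" and "h' = newton H"
  let ?c = "\<lambda>n. (inv_phi\<^sup>2) ^ n"
  define S where "S = (\<lambda>x y :: nat \<Rightarrow> real. (\<Sum>n. x n * y n * ?c n))"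
  have sums: "(\<lambda>n. (g n + t * g' n) * (h n + t * h' n) * ?c n) sums
      (S g h + t * S g h' + t * S g' h + t\<^sup>2 * S g' h')" for t
  proof -
    have "(\<lambda>n. g n * h n * ?c n + t * (g n * h' n * ?c n) + t * (g' n * h n * ?c n)
        + t\<^sup>2 * (g' n * h' n * ?c n)) sums (S g h + t * S g h' + t * S g' h + t\<^sup>2 * S g' h')"
      unfolding S_def g_def h_def g'_def h'_def
      by (intro sums_add sums_mult summable_sums summable_newton_mult)
    then show ?thesis by (simp add: algebra_simps power2_eq_square)
  qed
  have "(\<Sum>n. (g n + inv_phi * g' n) * (h n + inv_phi * h' n) * ?c n)
      = (\<Sum>n. inv_phi\<^sup>2 * ((g n + golden_ratio * g' n) * (h n + golden_ratio * h' n) * ?c n))"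
  proof (rule suminf_shift_eq)
    show "(g (Suc n) + inv_phi * g' (Suc n)) * (h (Suc n) + inv_phi * h' (Suc n)) * ?c (Suc n)
        = inv_phi\<^sup>2 * ((g n + golden_ratio * g' n) * (h n + golden_ratio * h' n) * ?c n)" for n
      unfolding g_def h_def g'_def h'_def newton_linear_factor by simp
    show "(g 0 + inv_phi * g' 0) * (h 0 + inv_phi * h' 0) * ?c 0 = 0"
      unfolding g_def g'_def newton_linear_factor_0 by simp
  qed (use sums sums_summable summable_mult in blast)+
  then have "S g h + inv_phi * S g h' + inv_phi * S g' h + inv_phi\<^sup>2 * S g' h'
      = inv_phi\<^sup>2 * (S g h + golden_ratio * S g h' + golden_ratio * S g' h + golden_ratio\<^sup>2 * S g' h')"
    using sums[of inv_phi] sums_mult[OF sums[of golden_ratio], of "inv_phi\<^sup>2"] by (simp add: sums_iff)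
  also have "\<dots> = inv_phi\<^sup>2 * S g h + inv_phi * (golden_ratio * inv_phi) * S g h' + inv_phi * (golden_ratio * inv_phi) * S g' h
      + (golden_ratio * inv_phi)\<^sup>2 * S g' h'"
    by (simp add: power2_eq_square algebra_simps)
  finally have "inv_phi * (S g h - S g' h') = 0"
    unfolding golden_ratio_inv_phi inv_phi_sq by (simp add: algebra_simps)
  then show ?thesis using inv_phi_pos by (simp add: S_def g_def h_def g'_def h'_def)
qed

text \<open>
  The powers of \<open>w - inv_phi\<close> are therefore orthogonal, all of squared norm \<open>golden_ratio\<close>.
  The induction peels off the constant term in powers of \<open>w - inv_phi\<close>.
\<close>

lemma newton_parseval:
  assumes "\<forall>i\<ge>m. coeff G i = 0"
  shows "(\<lambda>n. newton (pcompose G [:- inv_phi, 1:]) n * newton (pcompose H [:- inv_phi, 1:]) n * (inv_phi\<^sup>2) ^ n)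
    sums (golden_ratio * (\<Sum>k<m. coeff G k * coeff H k))"
  using assms
proof (induction G H arbitrary: m rule: poly_induct2)
  case 0
  then show ?case by simp
next
  case (pCons a G b H)
  let ?G = "pcompose G [:- inv_phi, 1:]" and ?H = "pcompose H [:- inv_phi, 1:]" and ?c = "\<lambda>n. (inv_phi\<^sup>2) ^ n"
  let ?g = "newton ([:- inv_phi, 1:] * ?G)" and ?h = "newton ([:- inv_phi, 1:] * ?H)"
  show ?case
  proof (cases m)
    case 0
    then have "pCons a G = 0" using pCons by (intro poly_eqI) auto
    then show ?thesis using 0 by simp
  next
    case (Suc m')
    then have "\<forall>i\<ge>m'. coeff G i = 0" using pCons(2) by (metis Suc_le_mono coeff_pCons_Suc)
    from pCons(1)[OF this] have IH: "(\<lambda>n. ?g n * ?h n * ?c n) sums (golden_ratio * (\<Sum>k<m'. coeff G k * coeff H k))"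
      using linear_factor_isometry[of ?G ?H] summable_newton_mult by (simp add: sums_iff)
    \<comment> \<open>The squared norm of the constant 1.\<close>
    have one: "?c sums golden_ratio"
    proof -
      have "1 / (1 - inv_phi\<^sup>2) = golden_ratio"
        unfolding inv_phi_sq using golden_ratio_inv_phi inv_phi_pos by (simp add: field_simps)
      then show ?thesis using geometric_sums[of "inv_phi\<^sup>2"] inv_phi_sq_bounds by simp
    qed
    have z: "(\<lambda>n. ?g n * ?c n) sums 0" "(\<lambda>n. ?h n * ?c n) sums 0"
      using suminf_linear_factor_eq_0 summable_newton by (simp_all add: sums_iff)
    have "(\<lambda>n. a * b * ?c n + b * (?g n * ?c n) + a * (?h n * ?c n) + ?g n * ?h n * ?c n) sums
       (a * b * golden_ratio + b * 0 + a * 0 + golden_ratio * (\<Sum>k<m'. coeff G k * coeff H k))"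
      by (intro sums_add sums_mult one IH z)
    then show ?thesis
      unfolding Suc sum.lessThan_Suc_shift pcompose_pCons newton_add newton_const
      by (simp add: algebra_simps)
  qed
qed

lemma pcompose_shift_inverse: "pcompose (pcompose G [:inv_phi, 1:]) [:- inv_phi, 1:] = G"
  by (simp flip: pcompose_assoc add: pcompose_pCons)

text \<open>
  Recentring at \<open>inv_phi\<close> does not change the leading coefficient, a nonzero integer, and by
  Parseval its square times \<open>golden_ratio\<close> is at most the squared norm.
\<close>

lemma newton_norm_ge_golden_ratio:
  assumes "\<And>k. coeff G k \<in> \<int>" "G \<noteq> 0"
  shows "golden_ratio \<le> (\<Sum>n. (newton G n)\<^sup>2 * (inv_phi\<^sup>2) ^ n)"
proof -
  define H where "H = pcompose G [:inv_phi, 1:]"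
  have d: "degree H = degree G" by (simp add: H_def degree_pcompose)
  have lc: "lead_coeff H = lead_coeff G"
    unfolding H_def by (subst lead_coeff_comp) auto
  have "(\<Sum>n. (newton G n)\<^sup>2 * (inv_phi\<^sup>2) ^ n) = golden_ratio * (\<Sum>k<Suc (degree G). coeff H k * coeff H k)"
    using newton_parseval[of "Suc (degree G)" H H] d unfolding H_def pcompose_shift_inverse
    by (simp add: sums_iff power2_eq_square coeff_eq_0)
  moreover have "1 \<le> (\<Sum>k<Suc (degree G). coeff H k * coeff H k)"
  proof -
    obtain i where i: "lead_coeff G = of_int i" using assms(1) Ints_cases by metis
    then have "i \<noteq> 0" using assms(2) by auto
    then have "1 \<le> i * i" by (auto simp: int_one_le_iff_zero_less zero_less_mult_iff linorder_neq_iff)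
    then have "1 \<le> lead_coeff G * lead_coeff G" unfolding i
      by (metis of_int_1_le_iff of_int_mult)
    then have "1 \<le> coeff H (degree G) * coeff H (degree G)" using lc d by simp
    also have "\<dots> \<le> (\<Sum>k<Suc (degree G). coeff H k * coeff H k)"
      by (rule member_le_sum) auto
    finally show ?thesis .
  qed
  ultimately show ?thesis using golden_ratio_gt_1 by simp
qed

section \<open>The norm with harmonic weight\<close>

text \<open>
  With weight \<open>1/n\<close> the norm of \<open>w K(w)\<close> is the Bergman norm of \<open>K\<close> on the unit disc centred
  at \<open>inv_phi\<close>. Writing \<open>K\<close> as the derivative of \<open>F\<close>, \<open>P\<close> and \<open>X\<close> for the values belonging to
  \<open>w K\<close> and \<open>F\<close>, one factor \<open>P(n) / n\<close> becomes the backward difference of \<open>X\<close>. Summation by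
  parts moves the difference onto \<open>P\<close>, where \<open>P(n) - inv_phi\<^sup>2 * P(n + 1)\<close> is \<open>inv_phi\<close> times
  the value belonging to \<open>(w - inv_phi) K\<close>, and Parseval applies. The term \<open>n = 0\<close> contributes
  zero on both readings: \<open>P(0) = 0\<close>, and division by zero is zero.
\<close>

lemma newton_dirichlet_norm:
  assumes "\<forall>i\<ge>m. coeff H i = 0"
  defines "K \<equiv> pcompose H [:- inv_phi, 1:]"
  shows "(\<lambda>n. (newton (pCons 0 K) n)\<^sup>2 / real n * (inv_phi\<^sup>2) ^ n) sums (\<Sum>k<m. (coeff H k)\<^sup>2 / real (Suc k))"
proof -
  define A where "A = (\<Sum>k<m. monom (coeff H k / real (Suc k)) (Suc k))"
  have cA: "coeff A (Suc k) = coeff H k / real (Suc k)" for k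
  proof -
    have "coeff A (Suc k) = (\<Sum>j<m. if j = k then coeff H j / real (Suc j) else 0)"
      unfolding A_def coeff_sum by (intro sum.cong) auto
    then show ?thesis using assms(1) by (auto simp: not_less)
  qed
  have pA: "pderiv A = H"
    by (rule poly_eqI) (simp add: coeff_pderiv cA del: of_nat_Suc)
  define F where "F = pcompose A [:- inv_phi, 1:]"
  have pF: "pderiv F = K" unfolding F_def K_def by (simp add: pderiv_pcompose pA pderiv_pCons)
  let ?P = "newton (pCons 0 K)" and ?X = "newton F" and ?c = "\<lambda>n. (inv_phi\<^sup>2) ^ n"
  have P0: "?P 0 = 0" by (simp add: newton_pCons_0)
  have split: "(?P (Suc n))\<^sup>2 / real (Suc n) * ?c (Suc n)
      = ?P (Suc n) * ?X (Suc n) * ?c (Suc n) - inv_phi\<^sup>2 * (?P (Suc n) * ?X n * ?c n)" for n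
  proof -
    have "?P (Suc n) / real (Suc n) = ?X (Suc n) - ?X n"
      using newton_times_pderiv[of F n] unfolding pF by simp
    moreover have "(?P (Suc n))\<^sup>2 / real (Suc n) * ?c (Suc n)
        = ?P (Suc n) * (?P (Suc n) / real (Suc n)) * ?c (Suc n)"
      by (simp add: power2_eq_square)
    ultimately show ?thesis by (simp only:) (simp add: algebra_simps)
  qed
  have 1: "(\<lambda>n. ?P (Suc n) * ?X (Suc n) * ?c (Suc n)) sums (\<Sum>n. ?P n * ?X n * ?c n)"
    using summable_sums[OF summable_newton_mult[of "pCons 0 K" F]] by (subst sums_Suc_iff) (simp add: P0)
  have 2: "(\<lambda>n. ?P (Suc n) * ?X n * ?c n) sums ((\<Sum>n. ?P n * ?X n * ?c n) + (\<Sum>n. newton K n * ?X n * ?c n))"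
    unfolding newton_shift distrib_right by (intro sums_add summable_sums summable_newton_mult)
  have "(\<lambda>n. (?P (Suc n))\<^sup>2 / real (Suc n) * ?c (Suc n)) sums
     ((\<Sum>n. ?P n * ?X n * ?c n) - inv_phi\<^sup>2 * ((\<Sum>n. ?P n * ?X n * ?c n) + (\<Sum>n. newton K n * ?X n * ?c n)))"
    unfolding split by (intro sums_diff sums_mult 1 2)
  also have "((\<Sum>n. ?P n * ?X n * ?c n) - inv_phi\<^sup>2 * ((\<Sum>n. ?P n * ?X n * ?c n) + (\<Sum>n. newton K n * ?X n * ?c n)))
     = inv_phi * ((\<Sum>n. ?P n * ?X n * ?c n) - inv_phi * (\<Sum>n. newton K n * ?X n * ?c n))"
    using inv_phi_sq by algebra
  also have "(\<Sum>n. ?P n * ?X n * ?c n) - inv_phi * (\<Sum>n. newton K n * ?X n * ?c n)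
     = (\<Sum>n. newton ([:- inv_phi, 1:] * K) n * ?X n * ?c n)"
  proof -
    have "(\<lambda>n. ?P n * ?X n * ?c n - inv_phi * (newton K n * ?X n * ?c n)) sums
       ((\<Sum>n. ?P n * ?X n * ?c n) - inv_phi * (\<Sum>n. newton K n * ?X n * ?c n))"
      by (intro sums_diff sums_mult summable_sums summable_newton_mult)
    then show ?thesis unfolding newton_times_linear by (simp add: sums_iff algebra_simps)
  qed
  also have "(\<Sum>n. newton ([:- inv_phi, 1:] * K) n * ?X n * ?c n)
     = golden_ratio * (\<Sum>k<Suc m. coeff (pCons 0 H) k * coeff A k)"
  proof -
    have "\<forall>i\<ge>Suc m. coeff (pCons 0 H) i = 0" using assms(1) by (auto simp: coeff_pCons split: nat.split)
    from newton_parseval[OF this, of A] show ?thesis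
      unfolding pcompose_pCons F_def[symmetric] K_def[symmetric] by (simp add: sums_iff)
  qed
  also have "inv_phi * (golden_ratio * (\<Sum>k<Suc m. coeff (pCons 0 H) k * coeff A k)) = (\<Sum>k<m. (coeff H k)\<^sup>2 / real (Suc k))"
    unfolding mult.assoc[symmetric] mult.commute[of inv_phi] golden_ratio_inv_phi sum.lessThan_Suc_shift
    by (simp add: cA power2_eq_square)
  finally show ?thesis
    by (subst (asm) sums_Suc_iff) simp
qed

section \<open>Geometry of numbers\<close>

text \<open>
  Products of Lebesgue measures over an index set serve as Euclidean space of variable
  dimension, since the dimension has to tend to infinity within one proof.
\<close>

lemma PiM_lborel_translate:
  fixes v :: "'i \<Rightarrow> real"
  assumes "finite I"
  shows "distr (Pi\<^sub>M I (\<lambda>_. lborel)) (Pi\<^sub>M I (\<lambda>_. lborel)) (\<lambda>x. \<lambda>i\<in>I. x i + v i) = Pi\<^sub>M I (\<lambda>_. lborel)"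
proof (rule product_sigma_finite.PiM_eqI)
  show "product_sigma_finite (\<lambda>_::'i. lborel :: real measure)" ..
  show "finite I" by fact
  let ?M = "Pi\<^sub>M I (\<lambda>_. lborel :: real measure)" and ?t = "\<lambda>x. \<lambda>i\<in>I. x i + v i"
  interpret product_sigma_finite "\<lambda>_::'i. lborel :: real measure" ..
  have t: "?t \<in> measurable ?M ?M" by measurable
  fix A :: "'i \<Rightarrow> real set" assume A: "\<And>i. i \<in> I \<Longrightarrow> A i \<in> sets lborel"
  have "emeasure (distr ?M ?M ?t) (Pi\<^sub>E I A) = emeasure ?M (?t -` Pi\<^sub>E I A \<inter> space ?M)"
    using A assms t by (intro emeasure_distr sets_PiM_I_finite) auto
  also have "?t -` Pi\<^sub>E I A \<inter> space ?M = Pi\<^sub>E I (\<lambda>i. (\<lambda>y. y + v i) -` A i)"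
    by (auto simp: space_PiM PiE_def Pi_def extensional_def)
  also have "emeasure ?M \<dots> = (\<Prod>i\<in>I. emeasure lborel ((\<lambda>y. y + v i) -` A i))"
    using A assms by (intro emeasure_PiM) (auto intro!: measurable_sets_borel[of _ borel])
  also have "\<dots> = (\<Prod>i\<in>I. emeasure lborel (A i))"
  proof (intro prod.cong refl)
    fix i assume "i \<in> I"
    have "emeasure (distr lborel borel ((+) (v i))) (A i) = emeasure lborel (((+) (v i)) -` A i \<inter> space lborel)"
      using A[OF \<open>i \<in> I\<close>] by (intro emeasure_distr) auto
    then show "emeasure lborel ((\<lambda>y. y + v i) -` A i) = emeasure lborel (A i)"
      by (simp add: lborel_distr_plus add.commute[of _ "v i"] vimage_def)
  qed
  finally show "emeasure (distr ?M ?M ?t) (Pi\<^sub>E I A) = (\<Prod>i\<in>I. emeasure lborel (A i))" .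
qed simp

text \<open>
  If translates of \<open>B\<close> by vectors \<open>l n\<close> cover \<open>E\<close>, cut \<open>E\<close> into disjoint pieces, one for each
  translate, and move the pieces back into \<open>B\<close>. They cannot stay disjoint when \<open>B\<close> has smaller
  volume, and a common point yields two points of \<open>E\<close> that differ by a difference of two
  distinct translation vectors.
\<close>

lemma blichfeldt:
  fixes l :: "nat \<Rightarrow> 'i \<Rightarrow> real" and I :: "'i set"
  defines "M \<equiv> Pi\<^sub>M I (\<lambda>_. lborel :: real measure)"
  assumes I: "finite I" and B: "B \<in> sets M" and E: "E \<in> sets M"
    and vol: "emeasure M B < emeasure M E"
    and cover: "\<And>x. x \<in> E \<Longrightarrow> \<exists>n. (\<lambda>i\<in>I. x i - l n i) \<in> B"
  shows "\<exists>x\<in>E. \<exists>y\<in>E. \<exists>m n. (\<exists>i\<in>I. l m i \<noteq> l n i) \<and> (\<forall>i\<in>I. x i - y i = l m i - l n i)"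
proof (rule ccontr)
  assume contra: "\<not> ?thesis"
  define t where "t v x = (\<lambda>i\<in>I. x i + v i)" for v x :: "'i \<Rightarrow> real"
  have t [measurable]: "t v \<in> measurable M M" for v
    unfolding t_def M_def by measurable
  have em: "emeasure M (t v -` A \<inter> space M) = emeasure M A" if "A \<in> sets M" for v A
    using that emeasure_distr[OF t, of A v] PiM_lborel_translate[OF I, of v]
    by (simp add: t_def[abs_def] M_def)
  define F where "F n = E \<inter> (t (\<lambda>i. - l n i) -` B \<inter> space M)" for n
  have F: "F n \<in> sets M" for n
    unfolding F_def using E B t measurable_sets by blast
  have EF: "E = (\<Union>n. F n)"
    using cover sets.sets_into_space[OF E] by (fastforce simp: F_def t_def)
  \<comment> \<open>Disjoint pieces make repetitions in the enumeration harmless: two pieces belonging to the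
    same vector remain disjoint after being moved back.\<close>
  define A where "A = disjointed F"
  have A: "A n \<in> sets M" for n
    unfolding A_def using F sets.range_disjointed_sets by blast
  have AF: "A n \<subseteq> F n" for n
    unfolding A_def by (rule disjointed_subset)
  define D where "D n = t (l n) -` A n \<inter> space M" for n
  have D: "D n \<in> sets M" for n
    unfolding D_def using A t measurable_sets by blast
  have "D n \<subseteq> B" for n
  proof
    fix z assume z: "z \<in> D n"
    then have "t (\<lambda>i. - l n i) (t (l n) z) \<in> B"
      using AF by (auto simp: D_def F_def)
    moreover have "t (\<lambda>i. - l n i) (t (l n) z) = z"
      using z by (auto simp: D_def M_def space_PiM t_def PiE_def extensional_def)
    ultimately show "z \<in> B" by simp
  qed
  moreover have "disjoint_family D"
    unfolding disjoint_family_on_def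
  proof (intro ballI impI)
    fix m n :: nat assume "m \<noteq> n"
    have False if "z \<in> D m" "z \<in> D n" for z
    proof -
      have *: "t (l m) z \<in> A m" "t (l n) z \<in> A n" using that by (auto simp: D_def)
      then have "t (l m) z \<in> E" "t (l n) z \<in> E" using AF by (auto simp: F_def)
      moreover have "\<forall>i\<in>I. t (l m) z i - t (l n) z i = l m i - l n i" by (simp add: t_def)
      ultimately have "\<forall>i\<in>I. l m i = l n i" using contra by blast
      then have "t (l m) z = t (l n) z" by (auto simp: t_def)
      with * show False
        using disjoint_family_disjointed[of F] \<open>m \<noteq> n\<close>
        unfolding A_def disjoint_family_on_def by auto
    qed
    then show "D m \<inter> D n = {}" by blast
  qed
  ultimately have "(\<Sum>n. emeasure M (D n)) \<le> emeasure M B"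
    using D B by (subst suminf_emeasure) (auto intro!: emeasure_mono)
  moreover have "(\<Sum>n. emeasure M (D n)) = emeasure M E"
  proof -
    have "(\<Sum>n. emeasure M (D n)) = (\<Sum>n. emeasure M (A n))"
      unfolding D_def using em A by simp
    also have "\<dots> = emeasure M (\<Union>n. A n)"
      using A disjoint_family_disjointed[of F] by (intro suminf_emeasure) (auto simp: A_def)
    also have "(\<Union>n. A n) = E"
      unfolding A_def EF by (rule UN_disjointed_eq)
    finally show ?thesis .
  qed
  ultimately show False using vol by simp
qed

lemma pcompose_monom: "pcompose (monom a n) p = smult a (p ^ n)"
  by (induction n) (simp_all add: monom_0 monom_Suc pcompose_pCons)

text \<open>
  The translates of the box with sides \<open>d k\<close> cover space for the lattice of recentred
  coefficient vectors of integer polynomials with \<open>k\<close>-th coefficient divisible by \<open>d k\<close>: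
  recentring is unitriangular, so the coordinates can be reduced from the highest to the
  lowest.
\<close>

lemma triangular_reduction:
  fixes d :: "nat \<Rightarrow> nat" and x :: "nat \<Rightarrow> real"
  assumes "\<And>k. d k > 0"
  shows "\<exists>K. (\<forall>k. \<exists>a::int. coeff K k = of_int (int (d k) * a)) \<and> (\<forall>k\<ge>n. coeff K k = 0) \<and>
    (\<forall>k<n. x k - coeff (pcompose K [:inv_phi, 1:]) k \<in> {0..<real (d k)})"
proof (induction n arbitrary: x)
  case 0
  show ?case by (rule exI[of _ 0]) simp
next
  case (Suc n)
  define a where "a = \<lfloor>x n / real (d n)\<rfloor>"
  define K0 :: "real poly" where "K0 = monom (of_int (int (d n) * a)) n"
  have top: "coeff (pcompose K0 [:inv_phi, 1:]) n = of_int (int (d n) * a)"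
  proof -
    have "pcompose K0 [:inv_phi, 1:] = smult (of_int (int (d n) * a)) ([:inv_phi, 1:] ^ n)"
      unfolding K0_def by (rule pcompose_monom)
    moreover have "coeff ([:inv_phi, 1:] ^ n) n = 1"
      by (rule coeff_linear_power)
    ultimately show ?thesis by simp
  qed
  obtain K1 where K1: "\<forall>k. \<exists>a::int. coeff K1 k = of_int (int (d k) * a)" "\<forall>k\<ge>n. coeff K1 k = 0"
    "\<forall>k<n. (x k - coeff (pcompose K0 [:inv_phi, 1:]) k) - coeff (pcompose K1 [:inv_phi, 1:]) k \<in> {0..<real (d k)}"
    using Suc[of "\<lambda>k. x k - coeff (pcompose K0 [:inv_phi, 1:]) k"] by blast
  have K1n: "coeff (pcompose K1 [:inv_phi, 1:]) n = 0"
  proof (cases "K1 = 0")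
    case False
    then have "degree K1 < n" using K1(2) leading_coeff_0_iff not_less by blast
    then show ?thesis by (intro coeff_eq_0) (simp add: degree_pcompose)
  qed simp
  have xn: "x n - of_int (int (d n) * a) \<in> {0..<real (d n)}"
    using floor_divide_lower[of "real (d n)" "x n"] floor_divide_upper[of "real (d n)" "x n"] assms[of n]
    by (simp add: a_def algebra_simps)
  show ?case
  proof (intro exI[of _ "K0 + K1"] conjI allI impI)
    fix k
    obtain a1 :: int where "coeff K1 k = of_int (int (d k) * a1)" using K1(1) by blast
    then have "coeff (K0 + K1) k = of_int (int (d k) * ((if k = n then a else 0) + a1))"
      by (simp add: K0_def algebra_simps)
    then show "\<exists>a::int. coeff (K0 + K1) k = of_int (int (d k) * a)" by blast
  next
    fix k assume "Suc n \<le> k" then show "coeff (K0 + K1) k = 0"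
      using K1(2) by (simp add: K0_def)
  next
    fix k assume "k < Suc n"
    then show "x k - coeff (pcompose (K0 + K1) [:inv_phi, 1:]) k \<in> {0..<real (d k)}"
      using K1(3) K1n top xn by (cases "k = n") (auto simp: pcompose_add algebra_simps)
  qed
qed

lemma countable_int_polys: "countable {K :: real poly. \<forall>k. coeff K k \<in> \<int>}"
proof (rule countable_subset)
  show "{K :: real poly. \<forall>k. coeff K k \<in> \<int>} \<subseteq> range (\<lambda>xs :: int list. Poly (map of_int xs))"
  proof
    fix K :: "real poly" assume "K \<in> {K. \<forall>k. coeff K k \<in> \<int>}"
    then have "set (coeffs K) \<subseteq> \<int>" by (auto simp: coeffs_def)
    then have "map of_int (map floor (coeffs K)) = coeffs K"
      by (auto intro!: map_idI simp: subset_iff elim!: Ints_cases)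
    then have "K = Poly (map of_int (map floor (coeffs K)))" by simp
    then show "K \<in> range (\<lambda>xs :: int list. Poly (map of_int xs))" by blast
  qed
qed auto

text \<open>
  Minkowski's convex body theorem for the Bergman norm. Dividing the \<open>k\<close>-th coordinate by
  \<open>sqrt (k + 1)\<close> turns the ellipsoid into a ball, and the fundamental box into one with sides
  \<open>d k / sqrt (k + 1)\<close>. Two points of the ball of radius \<open>sqrt R / 2\<close> have distance at most
  \<open>sqrt R\<close>.
\<close>

lemma exists_small_dirichlet_norm:
  fixes d :: "nat \<Rightarrow> nat" and R :: real
  assumes d: "\<And>k. d k > 0" and R: "R > 0"
    and vol: "(\<Prod>k<n. real (d k) / sqrt (real (Suc k))) < unit_ball_vol (real n) * (sqrt R / 2) ^ n"
  shows "\<exists>K. (\<forall>k. \<exists>a::int. coeff K k = of_int (int (d k) * a)) \<and> (\<forall>k\<ge>n. coeff K k = 0) \<and> K \<noteq> 0 \<and>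
      (\<Sum>k<n. (coeff (pcompose K [:inv_phi, 1:]) k)\<^sup>2 / real (Suc k)) \<le> R"
proof -
  let ?M = "Pi\<^sub>M {..<n} (\<lambda>_. lborel :: real measure)"
  interpret product_sigma_finite "\<lambda>_::nat. lborel :: real measure" ..
  define s where "s k = sqrt (real (Suc k))" for k
  have s: "s k > 0" for k by (simp add: s_def)
  define \<K> :: "real poly set"
    where "\<K> = {K. (\<forall>k. \<exists>a::int. coeff K k = of_int (int (d k) * a)) \<and> (\<forall>k\<ge>n. coeff K k = 0)}"
  have "countable \<K>"
  proof (rule countable_subset[OF _ countable_int_polys])
    have "coeff K k \<in> \<int>" if K: "K \<in> \<K>" for K k
    proof -
      obtain a :: int where "coeff K k = of_int (int (d k) * a)"
        using K unfolding \<K>_def by blast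
      then show ?thesis by simp
    qed
    then show "\<K> \<subseteq> {K. \<forall>k. coeff K k \<in> \<int>}" by blast
  qed
  moreover have "0 \<in> \<K>" by (simp add: \<K>_def)
  ultimately have "range (from_nat_into \<K>) = \<K>"
    by (intro range_from_nat_into) auto
  then obtain K :: "nat \<Rightarrow> real poly" where K: "range K = \<K>" ..
  define l where "l m k = coeff (pcompose (K m) [:inv_phi, 1:]) k / s k" for m k
  define B where "B = Pi\<^sub>E {..<n} (\<lambda>k. {0..<real (d k) / s k})"
  define E where "E = {f. sqrt (\<Sum>i<n. (f i)\<^sup>2) \<le> sqrt R / 2} \<inter> space ?M"
  have "\<exists>x\<in>E. \<exists>y\<in>E. \<exists>i j. (\<exists>k\<in>{..<n}. l i k \<noteq> l j k) \<and> (\<forall>k\<in>{..<n}. x k - y k = l i k - l j k)"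
  proof (rule blichfeldt)
    show "B \<in> sets ?M" unfolding B_def by (intro sets_PiM_I_finite) auto
    show "E \<in> sets ?M" unfolding E_def by measurable
    have "emeasure ?M B = (\<Prod>k<n. emeasure lborel {0..<real (d k) / s k})"
      unfolding B_def by (intro emeasure_PiM) auto
    also have "\<dots> = ennreal (\<Prod>k<n. real (d k) / s k)"
      using s by (simp add: prod_ennreal less_imp_le)
    also have "\<dots> < ennreal (unit_ball_vol (real n) * (sqrt R / 2) ^ n)"
      using vol R by (intro ennreal_lessI) (simp_all add: s_def)
    also have "\<dots> = emeasure ?M E"
      using emeasure_cball_aux[of "{..<n}" "sqrt R / 2"] R unfolding E_def by simp
    finally show "emeasure ?M B < emeasure ?M E" .
  next
    fix x assume "x \<in> E"
    obtain J where "J \<in> \<K>" and J: "\<forall>k<n. s k * x k - coeff (pcompose J [:inv_phi, 1:]) k \<in> {0..<real (d k)}"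
      using triangular_reduction[of d n "\<lambda>k. s k * x k"] d unfolding \<K>_def by blast
    then obtain m where m: "J = K m" using K by blast
    have "x k - l m k \<in> {0..<real (d k) / s k}" if "k < n" for k
    proof -
      have "x k - l m k = (s k * x k - coeff (pcompose J [:inv_phi, 1:]) k) / s k"
        using s[of k] by (simp add: l_def m diff_divide_distrib)
      then show ?thesis
        using J[rule_format, OF that] s[of k] by (simp add: divide_strict_right_mono)
    qed
    then have "(\<lambda>k\<in>{..<n}. x k - l m k) \<in> B"
      by (auto simp: B_def)
    then show "\<exists>m. (\<lambda>k\<in>{..<n}. x k - l m k) \<in> B" ..
  qed simp
  then obtain x y i j k where xy: "x \<in> E" "y \<in> E" and ne: "k < n" "l i k \<noteq> l j k"
    and diff: "\<And>k. k < n \<Longrightarrow> x k - y k = l i k - l j k" by auto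
  have KK: "K i \<in> \<K>" "K j \<in> \<K>" using K by auto
  show ?thesis
  proof (intro exI[of _ "K i - K j"] conjI allI impI)
    fix k
    obtain a b :: int where "coeff (K i) k = of_int (int (d k) * a)" "coeff (K j) k = of_int (int (d k) * b)"
      using KK unfolding \<K>_def by blast
    then have "coeff (K i - K j) k = of_int (int (d k) * (a - b))" by (simp add: algebra_simps)
    then show "\<exists>a::int. coeff (K i - K j) k = of_int (int (d k) * a)" by blast
  next
    fix k assume "n \<le> k" then show "coeff (K i - K j) k = 0" using KK by (simp add: \<K>_def)
  next
    show "K i - K j \<noteq> 0" using ne by (auto simp: l_def)
  next
    have "(\<Sum>k<n. (coeff (pcompose (K i - K j) [:inv_phi, 1:]) k)\<^sup>2 / real (Suc k)) = (\<Sum>k<n. (x k - y k)\<^sup>2)"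
    proof (intro sum.cong refl)
      fix k assume "k \<in> {..<n}"
      then show "(coeff (pcompose (K i - K j) [:inv_phi, 1:]) k)\<^sup>2 / real (Suc k) = (x k - y k)\<^sup>2"
        using diff[of k] by (simp add: l_def s_def pcompose_diff power_divide flip: diff_divide_distrib)
    qed
    also have "\<dots> = (L2_set (\<lambda>k. x k - y k) {..<n})\<^sup>2"
      by (simp add: L2_set_def sum_nonneg)
    also have "\<dots> \<le> (sqrt R)\<^sup>2"
    proof (rule power_mono)
      have "L2_set (\<lambda>k. x k - y k) {..<n} \<le> L2_set x {..<n} + L2_set (\<lambda>k. - y k) {..<n}"
        using L2_set_triangle_ineq[of x "\<lambda>k. - y k"] by simp
      also have "\<dots> \<le> sqrt R"
        using xy by (simp add: E_def L2_set_def)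
      finally show "L2_set (\<lambda>k. x k - y k) {..<n} \<le> sqrt R" .
    qed (simp add: L2_set_nonneg)
    finally show "(\<Sum>k<n. (coeff (pcompose (K i - K j) [:inv_phi, 1:]) k)\<^sup>2 / real (Suc k)) \<le> R"
      using R by simp
  qed
qed

text \<open>
  In dimension \<open>n = 2 * m\<close> the ball has volume \<open>(pi * R / 4) ^ m / fact m\<close> and the box has
  volume \<open>M ^ s / sqrt (fact n)\<close> once \<open>n \<ge> s\<close>. After squaring, their ratio is governed by the
  central binomial coefficient, which is \<open>4 ^ m\<close> up to a factor linear in \<open>m\<close>. So the ratio
  grows as soon as \<open>pi * R / 2 > 1\<close>, whatever the fixed \<open>M\<close> and \<open>s\<close>: this is where the
  constant \<open>2 / pi\<close> comes from.
\<close>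

lemma exists_large_ball:
  fixes R :: real and M s :: nat
  assumes "2 / pi < R" "M > 0"
  shows "\<exists>n. (\<Prod>k<n. real (if k < s then M else 1) / sqrt (real (Suc k))) < unit_ball_vol (real n) * (sqrt R / 2) ^ n"
proof -
  define \<delta> where "\<delta> = pi * R / 2"
  have \<delta>: "\<delta> > 1" using assms(1) by (simp add: \<delta>_def field_simps)
  have R: "R > 0" using assms(1) pi_gt_zero by (meson divide_pos_pos less_trans zero_less_numeral)
  have "filterlim (\<lambda>m. \<delta> ^ (2 * m) / real (2 * m)) at_top sequentially"
    using \<delta> by real_asymp
  then have "eventually (\<lambda>m. \<delta> ^ (2 * m) / real (2 * m) > (real M ^ s)\<^sup>2 \<and> m > 0 \<and> m \<ge> s) sequentially"
    by (intro eventually_conj eventually_gt_at_top eventually_ge_at_top) (simp add: filterlim_at_top_dense)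
  then obtain m where m: "\<delta> ^ (2 * m) / real (2 * m) > (real M ^ s)\<^sup>2" "m > 0" "m \<ge> s"
    by (metis (mono_tags, lifting) eventually_happens trivial_limit_sequentially)
  define n where "n = 2 * m"
  have lhs: "(\<Prod>k<n. real (if k < s then M else 1) / sqrt (real (Suc k))) = real M ^ s / sqrt (fact n)"
  proof -
    have "(\<Prod>k<n. real (if k < s then M else 1)) = (\<Prod>k<s. real M)"
      using m(3) by (intro prod.mono_neutral_cong_right) (auto simp: n_def)
    moreover have "(\<Prod>k<n. sqrt (real (Suc k))) = sqrt (fact n)"
      by (induction n) (simp_all add: real_sqrt_mult)
    ultimately show ?thesis by (simp add: prod_dividef)
  qed
  have rhs: "unit_ball_vol (real n) * (sqrt R / 2) ^ n = (pi * R / 4) ^ m / fact m"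
  proof -
    have "(sqrt R / 2) ^ n = (R / 4) ^ m"
      unfolding n_def power_mult using R by (simp add: power_divide)
    then show ?thesis
      using unit_ball_vol_even[of m] by (simp add: n_def power_mult_distrib power_divide)
  qed
  have "4 ^ m / real (2 * m) \<le> real (2 * m choose m)"
    using central_binomial_lower_bound[OF m(2)] by simp
  also have "\<dots> = fact n / (fact m)\<^sup>2"
    by (simp add: binomial_fact n_def power2_eq_square)
  finally have cb: "4 ^ m / real (2 * m) \<le> fact n / (fact m)\<^sup>2" .
  have "(real M ^ s)\<^sup>2 < \<delta> ^ (2 * m) / real (2 * m)" by (rule m)
  also have "\<dots> = ((pi * R / 4) ^ m)\<^sup>2 * (4 ^ m / real (2 * m))"
  proof -
    have "\<delta> ^ (2 * m) = ((pi * R / 4)\<^sup>2) ^ m * 4 ^ m"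
      unfolding power_mult power_mult_distrib[symmetric]
      by (simp add: \<delta>_def power2_eq_square mult_ac)
    moreover have "((pi * R / 4)\<^sup>2) ^ m = ((pi * R / 4) ^ m)\<^sup>2"
      by (metis power_mult mult.commute)
    ultimately show ?thesis by simp
  qed
  also have "\<dots> \<le> ((pi * R / 4) ^ m)\<^sup>2 * (fact n / (fact m)\<^sup>2)"
    by (intro mult_left_mono cb) simp
  also have "\<dots> = ((pi * R / 4) ^ m / fact m * sqrt (fact n))\<^sup>2"
    by (simp add: power_mult_distrib power_divide)
  finally have "real M ^ s < (pi * R / 4) ^ m / fact m * sqrt (fact n)"
    by (rule power_less_imp_less_base) (use R in simp)
  then show ?thesis
    using lhs rhs by (intro exI[of _ n]) (simp add: divide_less_eq del: power_mult_distrib)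
qed

text \<open>
  The divisibility of the values up to \<open>s\<close> serves to produce polynomials outside any given
  finite set. Small norm comes from restricting to polynomials that vanish at zero, for which
  the weight \<open>1 / (n + 1)\<close> may be replaced by the larger \<open>1 / n\<close>.
\<close>

lemma exists_small_integer_valued_poly:
  fixes R :: real and M s :: nat
  assumes "2 / pi < R" "M > 0"
  shows "\<exists>P. integer_valued P \<and> P \<noteq> 0 \<and> (\<forall>n\<le>s. \<exists>a::int. poly P (real n) = of_int (int M * a)) \<and>
    (\<Sum>n. 1 / real (n + 1) * (poly P (real n))\<^sup>2 * (inv_phi\<^sup>2) ^ n) \<le> R"
proof -
  define d where "d k = (if k < s then M else 1)" for k
  have d: "d k > 0" for k using assms by (simp add: d_def)
  have R: "R > 0" using assms(1) pi_gt_zero by (meson divide_pos_pos less_trans zero_less_numeral)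
  obtain N where "(\<Prod>k<N. real (d k) / sqrt (real (Suc k))) < unit_ball_vol (real N) * (sqrt R / 2) ^ N"
    using exists_large_ball[OF assms] unfolding d_def by blast
  from exists_small_dirichlet_norm[OF d R this] obtain K where
    K: "\<forall>k. \<exists>a::int. coeff K k = of_int (int (d k) * a)" "\<forall>k\<ge>N. coeff K k = 0" "K \<noteq> 0"
    and le: "(\<Sum>k<N. (coeff (pcompose K [:inv_phi, 1:]) k)\<^sup>2 / real (Suc k)) \<le> R" by blast
  define H where "H = pcompose K [:inv_phi, 1:]"
  define P where "P = newton_poly (pCons 0 K)"
  have P: "poly P (real n) = newton (pCons 0 K) n" for n
    by (simp add: P_def poly_newton_poly)
  have H0: "\<forall>i\<ge>N. coeff H i = 0"
  proof (intro allI impI coeff_eq_0)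
    fix i assume "N \<le> i"
    moreover have "degree K < N" using K(2,3) leading_coeff_0_iff not_less by blast
    ultimately show "degree H < i" by (simp add: H_def degree_pcompose)
  qed
  have "H \<noteq> 0" using K(3) pcompose_shift_inverse[of K] by (auto simp: H_def)
  have sums: "(\<lambda>n. (poly P (real n))\<^sup>2 / real n * (inv_phi\<^sup>2) ^ n) sums (\<Sum>k<N. (coeff H k)\<^sup>2 / real (Suc k))"
    using newton_dirichlet_norm[OF H0] unfolding H_def pcompose_shift_inverse P by simp
  have "integer_valued P"
    unfolding P_def
  proof (rule integer_valued_newton_poly)
    fix k
    have "coeff K j \<in> \<int>" for j using K(1) Ints_of_int by metis
    then show "coeff (pCons 0 K) k \<in> \<int>" by (cases k) auto
  qed
  moreover have "P \<noteq> 0"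
  proof
    assume "P = 0"
    then have "(\<Sum>k<N. (coeff H k)\<^sup>2 / real (Suc k)) = 0"
      using sums by (simp add: sums_iff)
    then have "\<forall>k<N. coeff H k = 0"
      by (subst (asm) sum_nonneg_eq_0_iff) auto
    then have "H = 0" using H0 by (intro poly_eqI) (metis coeff_0 not_less)
    with \<open>H \<noteq> 0\<close> show False by simp
  qed
  moreover have "\<exists>a::int. poly P (real n) = of_int (int M * a)" if "n \<le> s" for n
  proof -
    have "\<exists>a::int. coeff (pCons 0 K) k = of_int (int M * a)" if "k \<le> n" for k
    proof (cases k)
      case (Suc j)
      then show ?thesis using K(1)[rule_format, of j] that \<open>n \<le> s\<close> by (simp add: d_def)
    qed (auto intro: exI[of _ 0])
    then obtain a :: "nat \<Rightarrow> int" where a: "\<And>k. k \<le> n \<Longrightarrow> coeff (pCons 0 K) k = of_int (int M * a k)"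
      by metis
    have "poly P (real n) = (\<Sum>k\<le>n. of_int (int M * a k) * real (n choose k))"
      unfolding P newton_def by (intro sum.cong refl) (simp only: a atMost_iff)
    also have "\<dots> = of_int (int M * (\<Sum>k\<le>n. a k * int (n choose k)))"
      by (simp add: sum_distrib_left mult.assoc)
    finally show ?thesis by blast
  qed
  moreover have "(\<Sum>n. 1 / real (n + 1) * (poly P (real n))\<^sup>2 * (inv_phi\<^sup>2) ^ n) \<le> R"
  proof -
    have "(\<Sum>n. 1 / real (n + 1) * (poly P (real n))\<^sup>2 * (inv_phi\<^sup>2) ^ n)
        \<le> (\<Sum>n. (poly P (real n))\<^sup>2 / real n * (inv_phi\<^sup>2) ^ n)"
    proof (rule suminf_le)
      fix n
      show "1 / real (n + 1) * (poly P (real n))\<^sup>2 * (inv_phi\<^sup>2) ^ n \<le> (poly P (real n))\<^sup>2 / real n * (inv_phi\<^sup>2) ^ n"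
      proof (cases "n = 0")
        case True
        then show ?thesis using P[of 0] by (simp add: newton_pCons_0)
      next
        case False
        then show ?thesis by (intro mult_right_mono) (simp_all add: frac_le)
      qed
    qed (use summable_sum_2[of P] sums in \<open>simp_all only: weight_eq power2_abs sums_iff\<close>)
    also have "\<dots> \<le> R" using sums le by (simp add: sums_iff H_def)
    finally show ?thesis .
  qed
  ultimately show ?thesis by blast
qed

section \<open>Integer-valued polynomials of small norm\<close>

theorem theorem1p2:
  shows "(\<not> (\<exists>P. integer_valued P \<and> P \<noteq> 0 \<and>
            (\<Sum>n. \<bar>poly P (real n)\<bar>\<^sup>2 * golden_ratio powi (- 2 * int n)) < golden_ratio)) \<and>
         (\<forall>\<epsilon>>0. infinite {P. integer_valued P \<and>
            (\<Sum>n. 1 / real (n + 1) * \<bar>poly P (real n)\<bar>\<^sup>2 * golden_ratio powi (- 2 * int n))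
              \<le> 2 / pi + \<epsilon>})"
proof (intro conjI allI impI notI)
  assume "\<exists>P. integer_valued P \<and> P \<noteq> 0 \<and>
            (\<Sum>n. \<bar>poly P (real n)\<bar>\<^sup>2 * golden_ratio powi (- 2 * int n)) < golden_ratio"
  then obtain P where P: "integer_valued P" "P \<noteq> 0"
    "(\<Sum>n. \<bar>poly P (real n)\<bar>\<^sup>2 * golden_ratio powi (- 2 * int n)) < golden_ratio" by blast
  obtain G where G: "\<And>k. coeff G k \<in> \<int>" "P = newton_poly G"
    using integer_valued_eq_newton_poly[OF P(1)] by blast
  then have "G \<noteq> 0" using P(2) by (auto simp: newton_poly_def)
  from newton_norm_ge_golden_ratio[OF G(1) this] P(3) show False
    unfolding weight_eq power2_abs G(2) poly_newton_poly by simp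
next
  fix \<epsilon> :: real assume "\<epsilon> > 0"
  let ?S = "{P. integer_valued P \<and>
      (\<Sum>n. 1 / real (n + 1) * \<bar>poly P (real n)\<bar>\<^sup>2 * golden_ratio powi (- 2 * int n)) \<le> 2 / pi + \<epsilon>}"
  assume fin: "finite ?S"
  \<comment> \<open>Every nonzero polynomial in the finite set has a nonzero value at some natural number up to s
    with modulus less than M. A polynomial whose values up to s are multiples of M avoids the set.\<close>
  have "\<exists>n. poly P (real n) \<noteq> 0" if "P \<noteq> 0" for P :: "real poly"
  proof (rule ccontr)
    assume "\<not> ?thesis"
    then have "range real \<subseteq> {x. poly P x = 0}" by auto
    moreover have "infinite (range real)" by (rule range_inj_infinite) simp
    ultimately show False using poly_roots_finite[OF that] finite_subset by blast
  qed
  then obtain w where w: "\<And>P :: real poly. P \<noteq> 0 \<Longrightarrow> poly P (real (w P)) \<noteq> 0" by metis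
  define s where "s = Max (w ` ?S)"
  define M where "M = Suc (nat \<lceil>\<Sum>P\<in>?S. \<bar>poly P (real (w P))\<bar>\<rceil>)"
  have "2 / pi < 2 / pi + \<epsilon>" "M > 0" using \<open>\<epsilon> > 0\<close> by (auto simp: M_def)
  from exists_small_integer_valued_poly[OF this, of s] obtain P where P: "integer_valued P" "P \<noteq> 0"
      "\<forall>n\<le>s. \<exists>a::int. poly P (real n) = of_int (int M * a)"
      "(\<Sum>n. 1 / real (n + 1) * (poly P (real n))\<^sup>2 * (inv_phi\<^sup>2) ^ n) \<le> 2 / pi + \<epsilon>" by blast
  then have PS: "P \<in> ?S" unfolding weight_eq power2_abs by simp
  then have "w P \<le> s" unfolding s_def using fin by (intro Max_ge) auto
  then obtain a :: int where a: "poly P (real (w P)) = of_int (int M * a)" using P(3) by blast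
  then have "a \<noteq> 0" using w[OF P(2)] by auto
  then have "1 \<le> \<bar>real_of_int a\<bar>" by linarith
  then have "real M \<le> \<bar>poly P (real (w P))\<bar>"
    unfolding a by (simp add: abs_mult mult_le_cancel_left1)
  also have "\<dots> \<le> (\<Sum>P\<in>?S. \<bar>poly P (real (w P))\<bar>)"
    using fin PS by (intro member_le_sum) auto
  also have "\<dots> < real M"
    unfolding M_def by linarith
  finally show False by simp
qed
end
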